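(* Let $n,k,s$ be positive integers, where $n$ and $s$ are even and $n\ge (s+2)k-2$. Then $\chi_c(\operatorname{KG}_s(n,k))=n-s(k-1)$.
   Context: $[n]=\{1,\dots,n\}$. A nonempty subset $\mathcal{S}\subseteq[n]$ is $s$-stable if for any two different $i,j\in\mathcal{S}$, $s\le|i-j|\le n-s$. $\operatorname{KG}_s(n,k)$ has as vertices all $s$-stable $k$-subsets of $[n]$, two vertices adjacent iff disjoint. For positive integers $p,d$, the circular complete graph $K_{p/d}$ has vertex set $[p]$, with $i,j$ adjacent iff $d\le|i-j|\le p-d$. The circular chromatic number $\chi_c(G)$ is the infimum (in fact minimum) of $p/d$ over all $p,d$ such that there is a graph homomorphism $G\to K_{p/d}$. *)

theory Defs
  imports Complex_Main "Graph_Theory.Pair_Digraph"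
begin

text \<open>Simple graphs are represented by the symmetric, loop-free digraphs of
  \<^locale>\<open>pair_graph\<close>: each edge is present as two opposite arcs.\<close>

definition s_stable :: "nat \<Rightarrow> nat \<Rightarrow> nat set \<Rightarrow> bool" where
  "s_stable n s S \<longleftrightarrow> S \<subseteq> {1..n} \<and> S \<noteq> {} \<and>
     (\<forall>i\<in>S. \<forall>j\<in>S. i \<noteq> j \<longrightarrow>
        int s \<le> \<bar>int i - int j\<bar> \<and> \<bar>int i - int j\<bar> \<le> int n - int s)"

definition stable_kneser_graph :: "nat \<Rightarrow> nat \<Rightarrow> nat \<Rightarrow> nat set pair_pre_digraph" where
  "stable_kneser_graph s n k =
     (let V = {S. s_stable n s S \<and> card S = k}
      in \<lparr> pverts = V, parcs = {(S, T). S \<in> V \<and> T \<in> V \<and> S \<inter> T = {}} \<rparr>)"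

definition circular_complete_graph :: "nat \<Rightarrow> nat \<Rightarrow> nat pair_pre_digraph" where
  "circular_complete_graph p d =
     \<lparr> pverts = {1..p},
       parcs = {(i, j). i \<in> {1..p} \<and> j \<in> {1..p} \<and>
         int d \<le> \<bar>int i - int j\<bar> \<and> \<bar>int i - int j\<bar> \<le> int p - int d} \<rparr>"

definition graph_homomorphism ::
    "'a pair_pre_digraph \<Rightarrow> 'b pair_pre_digraph \<Rightarrow> ('a \<Rightarrow> 'b) \<Rightarrow> bool" where
  "graph_homomorphism G H f \<longleftrightarrow>
     f ` pverts G \<subseteq> pverts H \<and> (\<forall>(u, v) \<in> parcs G. (f u, f v) \<in> parcs H)"

definition circular_chromatic_number :: "'a pair_pre_digraph \<Rightarrow> real" where
  "circular_chromatic_number G =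
     Inf {real p / real d | p d. 0 < p \<and> 0 < d \<and>
            (\<exists>f. graph_homomorphism G (circular_complete_graph p d) f)}"

lemma finite_s_stable: "finite {S. s_stable n s S}"
  by (rule finite_subset[of _ "Pow {1..n}"]) (auto simp: s_stable_def)

lemma pair_graph_stable_kneser_graph: "pair_graph (stable_kneser_graph s n k)"
proof -
  let ?G = "stable_kneser_graph s n k"
  have fin: "finite (pverts ?G)"
    by (rule finite_subset[OF _ finite_s_stable[of n s]]) (auto simp: stable_kneser_graph_def)
  have arcs: "parcs ?G \<subseteq> pverts ?G \<times> pverts ?G"
    by (auto simp: stable_kneser_graph_def Let_def)
  have "finite (parcs ?G)"
    by (rule finite_subset[OF arcs]) (simp add: fin)
  moreover have "sym (parcs ?G)"
    by (rule symI) (auto simp: stable_kneser_graph_def Let_def)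
  moreover have "fst e \<noteq> snd e" if "e \<in> parcs ?G" for e
    using that by (cases e) (simp add: stable_kneser_graph_def s_stable_def Let_def, blast)
  moreover have "fst e \<in> pverts ?G" "snd e \<in> pverts ?G" if "e \<in> parcs ?G" for e
    using subsetD[OF arcs that] by (simp_all add: mem_Times_iff)
  ultimately show ?thesis
    using fin by unfold_locales (simp_all add: symmetric_def)
qed

lemma pair_graph_circular_complete_graph:
  assumes "0 < d"
  shows "pair_graph (circular_complete_graph p d)"
proof -
  let ?G = "circular_complete_graph p d"
  have fin: "finite (pverts ?G)"
    by (simp add: circular_complete_graph_def)
  have arcs: "parcs ?G \<subseteq> pverts ?G \<times> pverts ?G"
    by (auto simp: circular_complete_graph_def)
  have "finite (parcs ?G)"
    by (rule finite_subset[OF arcs]) (simp add: fin)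
  moreover have "sym (parcs ?G)"
    by (rule symI) (simp add: circular_complete_graph_def abs_minus_commute)
  moreover have "fst e \<noteq> snd e" if "e \<in> parcs ?G" for e
    using that assms by (cases e) (simp add: circular_complete_graph_def, linarith)
  moreover have "fst e \<in> pverts ?G" "snd e \<in> pverts ?G" if "e \<in> parcs ?G" for e
    using subsetD[OF arcs that] by (simp_all add: mem_Times_iff)
  ultimately show ?thesis
    using fin by unfold_locales (simp_all add: symmetric_def)
qed

end

theory Submission
  imports Defs
begin

text \<open>Write \<open>s = 2 * q\<close>, \<open>m = q * (k - 1) + 1\<close> and \<open>t = n - s * (k - 1) = n - 2 * m + 2\<close>, an even
  number. The minimum of a set is a proper colouring with \<open>t\<close> colours. Conversely, under the
  hypothesis on \<open>n\<close> every 2-stable \<open>m\<close>-subset of the cycle contains an \<open>s\<close>-stable \<open>k\<close>-subset,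
  so that a homomorphism to \<open>K\<^bsub>p/d\<^esub>\<close> colours the 2-stable \<open>m\<close>-subsets as well. By Fan's lemma
  there are 2-stable \<open>m\<close>-sets \<open>v 0, \<dots>, v (t - 1)\<close> with increasing colours such that \<open>v i\<close> and \<open>v j\<close>
  are disjoint if \<open>i + j\<close> is odd. Consecutive colours then differ by at least \<open>d\<close>, and, \<open>t\<close> being
  even, the first and the last one by at most \<open>p - d\<close>; hence \<open>t * d \<le> p\<close>.\<close>

section \<open>An alternating flag for antipodal signs (Fan's lemma)\<close>

text \<open>The points moved by \<open>f\<close> fall into pairs \<open>{x, f x}\<close>, which can
  be removed one pair at a time without changing the parity.\<close>

lemma even_card_involution:
  assumes "finite S" "\<And>x. x \<in> S \<Longrightarrow> f x \<in> S" "\<And>x. x \<in> S \<Longrightarrow> f (f x) = x"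
  shows "even (card S) \<longleftrightarrow> even (card {x \<in> S. f x = x})"
  using assms
proof (induction "card S" arbitrary: S rule: less_induct)
  case less
  show ?case
  proof (cases "\<forall>x\<in>S. f x = x")
    case True
    then have "{x \<in> S. f x = x} = S" by auto
    then show ?thesis by simp
  next
    case False
    then obtain x where x: "x \<in> S" "f x \<noteq> x" by blast
    let ?T = "S - {x, f x}"
    have sub: "{x, f x} \<subseteq> S" using x less.prems by auto
    have c: "card S = card ?T + 2"
      using card_Diff_subset[of "{x, f x}" S] sub x card_mono[OF less.prems(1) sub] by simp
    have closed: "f y \<in> ?T" if "y \<in> ?T" for y
      using that less.prems(2,3) x(1) by (metis DiffE DiffI insert_iff singletonD)
    have "even (card ?T) \<longleftrightarrow> even (card {y \<in> ?T. f y = y})"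
      by (rule less.hyps) (use c less.prems closed in auto)
    moreover have "{y \<in> ?T. f y = y} = {y \<in> S. f y = y}"
      using x less.prems by auto
    ultimately show ?thesis using c by simp
  qed
qed

text \<open>A sign vector with support in \<open>{1..n}\<close> is encoded as a set of nonzero integers that does not
  contain both \<open>x\<close> and \<open>- x\<close>. A maximal flag of such vectors is the sequence of prefixes of a
  signed permutation.\<close>

definition signed_perms :: "nat \<Rightarrow> int list set" where
  "signed_perms n = {w. distinct (map abs w) \<and> abs ` set w = {1..int n}}"

lemma length_signed_perms: "w \<in> signed_perms n \<Longrightarrow> length w = n"
  using distinct_card[of "map abs w"] by (simp add: signed_perms_def)

lemma finite_signed_perms: "finite (signed_perms n)"
proof (rule finite_subset)
  show "signed_perms n \<subseteq> {w. set w \<subseteq> {- int n..int n} \<and> length w = n}"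
  proof
    fix w assume w: "w \<in> signed_perms n"
    have "x \<in> {- int n..int n}" if "x \<in> set w" for x
    proof -
      have "\<bar>x\<bar> \<in> {1..int n}" using that w by (auto simp: signed_perms_def)
      then show ?thesis by auto
    qed
    then show "w \<in> {w. set w \<subseteq> {- int n..int n} \<and> length w = n}"
      using w by (auto simp: length_signed_perms)
  qed
  show "finite {w. set w \<subseteq> {- int n..int n} \<and> length w = n}"
    by (rule finite_lists_length_eq) simp
qed

lemma signed_perms_uminus:
  assumes "w \<in> signed_perms n" shows "map uminus w \<in> signed_perms n"
proof -
  have "map abs (map uminus w) = map abs w" by simp
  then show ?thesis using assms unfolding signed_perms_def
    by (metis (mono_tags, lifting) mem_Collect_eq set_map)
qed

lemma signed_perms_swap:
  assumes "w \<in> signed_perms n" "i < n" "j < n"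
  shows "w[i := w ! j, j := w ! i] \<in> signed_perms n"
proof -
  have l: "length w = n" using assms length_signed_perms by blast
  have "map abs (w[i := w ! j, j := w ! i])
        = (map abs w)[i := map abs w ! j, j := map abs w ! i]"
    using assms l by (simp add: map_update)
  then have "distinct (map abs (w[i := w ! j, j := w ! i]))"
    using assms l by (simp only: distinct_swap length_map) (simp add: signed_perms_def)
  moreover have "set (w[i := w ! j, j := w ! i]) = set w"
    using assms l by (simp add: set_swap)
  ultimately show ?thesis using assms by (simp add: signed_perms_def)
qed

lemma signed_perms_flip:
  assumes "w \<in> signed_perms n" "i < n"
  shows "w[i := - (w ! i)] \<in> signed_perms n"
proof -
  have l: "length w = n" using assms length_signed_perms by blast
  have "map abs (w[i := - (w ! i)]) = (map abs w)[i := map abs w ! i]"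
    using assms l by (simp add: map_update)
  then have "map abs (w[i := - (w ! i)]) = map abs w" by (simp only: list_update_id)
  then show ?thesis using assms unfolding signed_perms_def
    by (metis (mono_tags, lifting) mem_Collect_eq set_map)
qed

lemma signed_perms_consistent:
  assumes "w \<in> signed_perms n" "x \<in> set w"
  shows "- x \<notin> set w"
proof
  assume m: "- x \<in> set w"
  have inj: "inj_on abs (set w)" using assms by (simp add: signed_perms_def distinct_map)
  have "x = - x" using inj_onD[OF inj _ assms(2) m] by simp
  then have "x = 0" by simp
  moreover have "\<bar>x\<bar> \<in> {1..int n}" using assms by (auto simp: signed_perms_def)
  ultimately show False by simp
qed

text \<open>Flags whose last entry is \<open>n + 1\<close> correspond to the flags one dimension
  lower, which makes the equator accessible to the induction.\<close>

lemma signed_perms_snoc: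
  "w @ [int (Suc n)] \<in> signed_perms (Suc n) \<longleftrightarrow> w \<in> signed_perms n"
proof -
  have e: "{1..int (Suc n)} = insert (int (Suc n)) {1..int n}" by auto
  have "insert (int (Suc n)) (abs ` set w) = insert (int (Suc n)) {1..int n}
      \<longleftrightarrow> abs ` set w = {1..int n}" if "int (Suc n) \<notin> abs ` set w"
    using that by (intro insert_ident) auto
  moreover have "int (Suc n) \<notin> abs ` set w" if "abs ` set w = {1..int n}"
    using that by simp
  moreover have "distinct (map abs (w @ [int (Suc n)])) \<longleftrightarrow>
      distinct (map abs w) \<and> int (Suc n) \<notin> abs ` set w"
    by (auto simp del: of_nat_Suc)
  moreover have "abs ` set (w @ [int (Suc n)]) = insert (int (Suc n)) (abs ` set w)"
    by simp
  ultimately show ?thesis unfolding signed_perms_def mem_Collect_eq e by metis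
qed

text \<open>The member with index \<open>t\<close> is the prefix of length \<open>t + 1\<close>.
  Agreement at all indices means the signs +, -, +, and so on; disagreement at all indices is the
  opposite pattern.\<close>

definition agrees :: "(int set \<Rightarrow> bool) \<Rightarrow> int list \<Rightarrow> nat \<Rightarrow> bool" where
  "agrees \<sigma> w t \<longleftrightarrow> (\<sigma> (set (take (Suc t) w)) \<longleftrightarrow> even t)"

text \<open>Induction on the dimension. In the hemisphere of flags containing \<open>+(n + 1)\<close>, count the pairs
  of a flag and an index whose deletion leaves the signs alternating with \<open>+\<close> first; that is the
  set \<open>D\<close>. The involution \<open>f\<close> replaces the deleted member by the only other possible one, and
  fixes exactly the pairs whose remaining flag lies in the equator. The involution \<open>g\<close> changes the
  index, and fixes exactly the pairs whose whole flag alternates.\<close>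

lemma odd_card_alternating:
  fixes \<sigma> :: "int set \<Rightarrow> bool"
  assumes anti: "\<And>A. finite A \<Longrightarrow> A \<noteq> {} \<Longrightarrow> (\<forall>x\<in>A. - x \<notin> A) \<Longrightarrow> \<sigma> (uminus ` A) \<longleftrightarrow> \<not> \<sigma> A"
  shows "odd (card {w \<in> signed_perms n. \<forall>t<n. agrees \<sigma> w t})"
proof (induction n)
  case 0
  have "{w \<in> signed_perms 0. \<forall>t<0. agrees \<sigma> w t} = {[]}"
    by (auto simp: signed_perms_def)
  then show ?case by simp
next
  case (Suc n)
  let ?U = "agrees \<sigma>"
  let ?W = "{w \<in> signed_perms (Suc n). int (Suc n) \<in> set w}"
  \<comment> \<open>Deleting member \<open>i\<close> moves every later member down by one position,
    which reverses the sign expected of it: hence agreement before \<open>i\<close> and disagreement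
    after it.\<close>
  define D where "D = {(w, i). w \<in> ?W \<and> i \<le> n \<and> (\<forall>t<i. ?U w t) \<and> (\<forall>t. i < t \<and> t \<le> n \<longrightarrow> \<not> ?U w t)}"
  have "D \<subseteq> signed_perms (Suc n) \<times> {..n}" by (auto simp: D_def)
  then have finD: "finite D" by (rule finite_subset) (simp add: finite_signed_perms)
  have len: "length w = Suc n" if "w \<in> signed_perms (Suc n)" for w
    using that length_signed_perms by blast

  \<comment> \<open>Exchanging two neighbouring entries changes only the prefix that ends between
    them. The full prefix can change only in the sign of its last entry; if that entry is
    \<open>n + 1\<close>, the flip would leave the hemisphere.\<close>
  define f where "f = (\<lambda>(w :: int list, i).
    if i < n then (w[i := w ! Suc i, Suc i := w ! i], i)
    else if w ! n = int (Suc n) then (w, i) else (w[n := - (w ! n)], i))"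
  have f: "f x \<in> D \<and> f (f x) = x" if "x \<in> D" for x
  proof -
    obtain w i where x: "x = (w, i)" by (cases x)
    then have w: "w \<in> signed_perms (Suc n)" "int (Suc n) \<in> set w" "i \<le> n"
      "\<And>t. t < i \<Longrightarrow> ?U w t" "\<And>t. i < t \<Longrightarrow> t \<le> n \<Longrightarrow> \<not> ?U w t"
      using that by (auto simp: D_def)
    have l: "length w = Suc n" using len w by blast
    show ?thesis
    proof (cases "i < n")
      case True
      let ?v = "w[i := w ! Suc i, Suc i := w ! i]"
      have "set (take (Suc t) ?v) = set (take (Suc t) w)" if "t \<noteq> i" "t \<le> n" for t
      proof (cases "t < i")
        case True then show ?thesis by simp
      next
        case False
        then have t: "i < Suc t" "Suc i < Suc t" using that by auto
        have "take (Suc t) ?v = (take (Suc t) w)[i := take (Suc t) w ! Suc i, Suc i := take (Suc t) w ! i]"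
          using t by (simp add: take_update_swap)
        also have "set \<dots> = set (take (Suc t) w)"
          by (rule set_swap) (use t l that in auto)
        finally show ?thesis .
      qed
      then have U: "?U ?v t = ?U w t" if "t \<noteq> i" "t \<le> n" for t
        using that by (simp add: agrees_def)
      have "?v \<in> signed_perms (Suc n)" using signed_perms_swap[OF w(1)] True by simp
      moreover have "set ?v = set w" using True l by (simp add: set_swap)
      ultimately have "f x \<in> D" using U w True by (auto simp: D_def f_def x)
      moreover have "?v[i := ?v ! Suc i, Suc i := ?v ! i] = w"
        using True l by (intro nth_equalityI) (auto simp: nth_list_update)
      ultimately show ?thesis using True by (simp add: f_def x)
    next
      case False
      then have i: "i = n" using w by simp
      show ?thesis
      proof (cases "w ! n = int (Suc n)")
        case True
        then show ?thesis using that i by (simp add: f_def x)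
      next
        case ne: False
        let ?v = "w[n := - (w ! n)]"
        have U: "?U ?v t = ?U w t" if "t < n" for t
          using that by (simp add: agrees_def)
        have v: "?v \<in> signed_perms (Suc n)" using signed_perms_flip[OF w(1)] by simp
        obtain j where j: "j < Suc n" "w ! j = int (Suc n)"
          using w(2) l by (metis in_set_conv_nth)
        then have "j \<noteq> n" using ne by blast
        then have "?v ! j = int (Suc n)" "j < length ?v" using j l by auto
        then have "int (Suc n) \<in> set ?v" by (metis nth_mem)
        then have "f x \<in> D" using U v w i ne by (auto simp: D_def f_def x)
        moreover have "- (w ! n) \<noteq> int (Suc n)"
          using signed_perms_consistent[OF w(1), of "w ! n"] w(2) l by (metis lessI nth_mem)
        ultimately show ?thesis using ne i l by (simp add: f_def x)
      qed
    qed
  qed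
  have fixf: "{x \<in> D. f x = x} = (\<lambda>w. (w @ [int (Suc n)], n)) ` {w \<in> signed_perms n. \<forall>t<n. ?U w t}"
    (is "?L = ?g ` ?R")
  proof (intro equalityI subsetI)
    fix x assume "x \<in> ?L"
    then obtain w i where x: "x = (w, i)" "(w, i) \<in> D" "f (w, i) = (w, i)" by (cases x) auto
    then have w: "w \<in> signed_perms (Suc n)" "int (Suc n) \<in> set w" "i \<le> n" "\<And>t. t < i \<Longrightarrow> ?U w t"
      by (auto simp: D_def)
    have l: "length w = Suc n" using len w by blast
    have dw: "distinct w" using w(1) by (simp add: signed_perms_def distinct_map)
    have i: "i = n"
    proof (rule ccontr)
      assume "i \<noteq> n"
      then have "i < n" using w by simp
      then have "w[i := w ! Suc i, Suc i := w ! i] = w" using x by (simp add: f_def)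
      then have "w ! i = w ! Suc i" using \<open>i < n\<close> l
        by (metis Suc_lessD Suc_less_eq length_list_update nth_list_update_eq)
      then show False using dw \<open>i < n\<close> l by (simp add: nth_eq_iff_index_eq)
    qed
    have last: "w ! n = int (Suc n)"
    proof (rule ccontr)
      assume ne: "w ! n \<noteq> int (Suc n)"
      then have "w[n := - (w ! n)] = w" using x i by (simp add: f_def)
      then have "w ! n = - (w ! n)" using l by (metis lessI nth_list_update_eq)
      then show False using signed_perms_consistent[OF w(1), of "w ! n"] l by (metis lessI nth_mem)
    qed
    let ?v = "take n w"
    have wv: "w = ?v @ [int (Suc n)]" using l last
      by (metis lessI take_Suc_conv_app_nth take_all_iff order_refl)
    then have "?v \<in> signed_perms n" using w(1) signed_perms_snoc by metis
    moreover have "?U ?v t" if "t < n" for t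
      using w(4)[of t] that i by (simp add: agrees_def min_absorb1)
    ultimately have "?v \<in> ?R" by blast
    then show "x \<in> ?g ` ?R" using wv x(1) i by (metis (no_types, lifting) imageI)
  next
    fix x assume "x \<in> ?g ` ?R"
    then obtain v where v: "v \<in> signed_perms n" "\<And>t. t < n \<Longrightarrow> ?U v t" "x = ?g v" by blast
    have l: "length v = n" using v length_signed_perms by blast
    have "?U (v @ [int (Suc n)]) t" if "t < n" for t
      using v(2)[OF that] that l by (simp add: agrees_def)
    moreover have "v @ [int (Suc n)] \<in> signed_perms (Suc n)" using v signed_perms_snoc by blast
    ultimately show "x \<in> ?L" using l v(3) by (auto simp: D_def f_def nth_append)
  qed
  have "inj_on ?g ?R" for R by (auto simp: inj_on_def)
  then have "card {x \<in> D. f x = x} = card ?R" unfolding fixf by (rule card_image)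
  then have "odd (card {x \<in> D. f x = x})" using Suc.IH by simp
  then have oddD: "odd (card D)" using even_card_involution[of D f] finD f by blast

  \<comment> \<open>If member \<open>i\<close> agrees, the index \<open>i + 1\<close> qualifies as
    well, otherwise \<open>i - 1\<close> does. This stops at \<open>i = n\<close> with agreement
    and, as \<open>0 - 1 = 0\<close> for naturals, at \<open>i = 0\<close> with
    disagreement.\<close>
  define g where "g = (\<lambda>(w, i). if ?U w i then (if i < n then (w, Suc i) else (w, i))
     else (w, i - 1))"
  have g: "g x \<in> D \<and> g (g x) = x" if "x \<in> D" for x
  proof -
    obtain w i where x: "x = (w, i)" by (cases x)
    then have w: "w \<in> ?W" "i \<le> n"
      "\<And>t. t < i \<Longrightarrow> ?U w t" "\<And>t. i < t \<Longrightarrow> t \<le> n \<Longrightarrow> \<not> ?U w t"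
      using that by (auto simp: D_def)
    show ?thesis
    proof (cases "?U w i")
      case True
      then have "?U w t" if "t < Suc i" for t using that w(3) less_antisym by blast
      then show ?thesis using True that w by (auto simp: g_def x D_def)
    next
      case False
      have "\<not> ?U w t" if "i - 1 < t" "t \<le> n" for t
        using that w(4)[of t] False by (cases "t = i") auto
      then show ?thesis using False that w by (cases i) (auto simp: g_def x D_def)
    qed
  qed
  have odd': "odd (card {x \<in> D. g x = x})"
    using even_card_involution[of D g] finD g oddD by blast
  let ?P = "{w \<in> ?W. \<forall>t<Suc n. ?U w t}" and ?N = "{w \<in> ?W. \<forall>t<Suc n. \<not> ?U w t}"
  have "{x \<in> D. g x = x} = (\<lambda>w. (w, n)) ` ?P \<union> (\<lambda>w. (w, 0)) ` ?N"
  proof (intro equalityI subsetI)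
    fix x assume "x \<in> {x \<in> D. g x = x}"
    then obtain w i where x: "x = (w, i)" "(w, i) \<in> D" "g (w, i) = (w, i)" by (cases x) auto
    then have w: "w \<in> ?W" "i \<le> n"
      "\<And>t. t < i \<Longrightarrow> ?U w t" "\<And>t. i < t \<Longrightarrow> t \<le> n \<Longrightarrow> \<not> ?U w t"
      by (auto simp: D_def)
    show "x \<in> (\<lambda>w. (w, n)) ` ?P \<union> (\<lambda>w. (w, 0)) ` ?N"
    proof (cases "?U w i")
      case True
      then have "i = n" using x w by (auto simp: g_def split: if_splits)
      then have "?U w t" if "t < Suc n" for t using that w(3) True less_antisym by blast
      then show ?thesis using w x \<open>i = n\<close> by auto
    next
      case False
      then have "i = 0" using x w by (auto simp: g_def split: if_splits)
      then have "\<not> ?U w t" if "t < Suc n" for t using that w(4)[of t] False by (cases "t = 0") auto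
      then show ?thesis using w x \<open>i = 0\<close> by auto
    qed
  next
    fix x assume "x \<in> (\<lambda>w. (w, n)) ` ?P \<union> (\<lambda>w. (w, 0)) ` ?N"
    then show "x \<in> {x \<in> D. g x = x}" by (auto simp: D_def g_def)
  qed
  moreover have "card ((\<lambda>w. (w, n)) ` ?P \<union> (\<lambda>w. (w, 0)) ` ?N) = card ?P + card ?N"
    by (subst card_Un_disjoint) (auto simp: finite_signed_perms card_image inj_on_def)
  ultimately have "odd (card ?P + card ?N)" using odd' by simp
  \<comment> \<open>By antipodality, negating all entries reverses every sign, so the flags with
    pattern -, +, ... in this hemisphere match the alternating flags in the other one.\<close>
  moreover have "card ?N = card {w \<in> signed_perms (Suc n). - int (Suc n) \<in> set w \<and> (\<forall>t<Suc n. ?U w t)}"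
    (is "_ = card ?M")
  proof (rule bij_betw_same_card)
    have flip: "?U (map uminus w) t = (\<not> ?U w t)" if w: "w \<in> signed_perms (Suc n)" and t: "t < Suc n" for w t
    proof -
      have "w \<noteq> []" using len[OF w] by auto
      then have "\<sigma> (uminus ` set (take (Suc t) w)) \<longleftrightarrow> \<not> \<sigma> (set (take (Suc t) w))"
        using signed_perms_consistent[OF w] by (intro anti) (auto dest: in_set_takeD)
      then show ?thesis by (auto simp: agrees_def take_map)
    qed
    have mm: "map uminus (map uminus w) = w" for w :: "int list"
      by (simp add: o_def)
    show "bij_betw (map uminus) ?N ?M"
    proof (rule bij_betw_byWitness[where f' = "map uminus"])
      show "map uminus ` ?N \<subseteq> ?M"
      proof
        fix v assume "v \<in> map uminus ` ?N"
        then obtain w where "v = map uminus w" "w \<in> ?N" by blast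
        then show "v \<in> ?M" using flip signed_perms_uminus[of w] imageI[of "int (Suc n)" "set w" uminus]
          by (simp del: of_nat_Suc)
      qed
      show "map uminus ` ?M \<subseteq> ?N"
      proof
        fix v assume "v \<in> map uminus ` ?M"
        then obtain w where "v = map uminus w" "w \<in> ?M" by blast
        then show "v \<in> ?N" using flip signed_perms_uminus[of w] imageI[of "- int (Suc n)" "set w" uminus]
          by (simp del: of_nat_Suc)
      qed
    qed (auto simp: mm simp del: map_map)
  qed
  moreover have "card ?P + card ?M = card {w \<in> signed_perms (Suc n). \<forall>t<Suc n. ?U w t}"
  proof -
    have "int (Suc n) \<in> set w \<or> - int (Suc n) \<in> set w" if "w \<in> signed_perms (Suc n)" for w
    proof -
      have "int (Suc n) \<in> abs ` set w" using that by (auto simp: signed_perms_def)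
      then obtain x where "x \<in> set w" "int (Suc n) = \<bar>x\<bar>" by blast
      then show ?thesis by (metis abs_if minus_minus)
    qed
    then have "{w \<in> signed_perms (Suc n). \<forall>t<Suc n. ?U w t} = ?P \<union> ?M" by blast
    moreover have "?P \<inter> ?M = {}" using signed_perms_consistent by blast
    ultimately show ?thesis by (simp add: card_Un_disjoint finite_signed_perms)
  qed
  ultimately show ?case by metis
qed

section \<open>Stable subsets of 2-stable sets\<close>

text \<open>The \<open>c i\<close> enumerate the lift to the naturals of a set of \<open>N\<close> points on the cycle of
  length \<open>n\<close>. A jump \<open>\<phi>\<close> goes to the first point at distance at least \<open>2 * q\<close>; consider a periodic
  orbit with \<open>m\<close> points and \<open>r\<close> rounds. If no \<open>k\<close> consecutive jumps fit into one round then
  \<open>m < k * r\<close>. As each jump overshoots by less than the gap before its target, and these gaps are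
  distinct, \<open>r * n \<le> m * (2 * q - 1) + n - 2 * (N - m)\<close>. For \<open>r \<ge> 2\<close> this contradicts the lower
  bound on \<open>n\<close>; for \<open>r = 1\<close> the jumps, of at most \<open>q\<close> points each, do not cover \<open>N\<close> points.\<close>

lemma greedy_jumps:
  fixes c :: "nat \<Rightarrow> nat"
  assumes per: "\<And>i. c (i + N) = c i + n" and gap: "\<And>i. c i + 2 \<le> c (Suc i)"
    and N: "N = q * (k - 1) + 1" and n: "(2 * q + 2) * k \<le> n + 2" and "0 < k" "0 < q"
  obtains g :: "nat \<Rightarrow> nat"
  where "\<And>j. c (g j) + 2 * q \<le> c (g (Suc j))" "c (g k) \<le> c (g 0) + n"
proof (cases "k = 1")
  case True
  \<comment> \<open>Here \<open>N = 1\<close>, so a single step is a whole round of length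
    \<open>n\<close>, which is at least \<open>2 * q\<close>; the identity serves as
    \<open>g\<close>.\<close>
  have "c j + 2 * q \<le> c (Suc j)" for j using per[of j] N n True by simp
  moreover have "c k \<le> c 0 + n" using per[of 0] N True by simp
  ultimately show ?thesis by (rule that)
next
  case False
  then have k: "2 \<le> k" using \<open>0 < k\<close> by simp
  have N0: "0 < N" using N by simp
  have sm: "strict_mono c" unfolding strict_mono_Suc_iff
    using gap by (metis add_2_eq_Suc' less_eq_Suc_le Suc_leD)
  have le: "c i \<le> c j \<longleftrightarrow> i \<le> j" for i j using sm by (rule strict_mono_less_eq)
  have lin: "c i + 2 * l \<le> c (i + l)" for i l
  proof (induction l)
    case (Suc l) then show ?case using gap[of "i + l"] by simp
  qed simp
  define \<phi> where "\<phi> i = (LEAST j. c i + 2 * q \<le> c j)" for i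
  have \<phi>: "c i + 2 * q \<le> c (\<phi> i)" for i
    unfolding \<phi>_def by (rule LeastI) (rule lin)
  have \<phi>_le: "\<phi> i \<le> j" if "c i + 2 * q \<le> c j" for i j
    unfolding \<phi>_def using that by (rule Least_le)
  have \<phi>_less: "c j < c i + 2 * q" if "j < \<phi> i" for i j
    using \<phi>_le[of i j] that by linarith
  have \<phi>_q: "\<phi> i \<le> i + q" for i by (rule \<phi>_le) (rule lin)
  have \<phi>_gt: "i < \<phi> i" for i using \<phi>[of i] \<open>0 < q\<close> le[of "\<phi> i" i] by linarith
  have \<phi>_per: "\<phi> (i + N) = \<phi> i + N" for i
  proof (rule antisym)
    show "\<phi> (i + N) \<le> \<phi> i + N" by (rule \<phi>_le) (use \<phi>[of i] per in simp)
    have "N \<le> \<phi> (i + N)" using \<phi>_gt[of "i + N"] by simp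
    then obtain j where j: "\<phi> (i + N) = j + N" by (metis add.commute le_Suc_ex)
    then have "c i + 2 * q \<le> c j" using \<phi>[of "i + N"] per by simp
    then show "\<phi> i + N \<le> \<phi> (i + N)" using j \<phi>_le by simp
  qed
  have per': "c (i + l * N) = c i + l * n" for i l
  proof (induction l)
    case (Suc l) then show ?case using per[of "i + l * N"] by (simp add: algebra_simps)
  qed simp
  have \<phi>_per': "\<phi> (i + l * N) = \<phi> i + l * N" for i l
  proof (induction l)
    case (Suc l) then show ?case using \<phi>_per[of "i + l * N"] by (simp add: algebra_simps)
  qed simp

  define x where "x j = (\<phi> ^^ j) 0" for j
  have x_Suc: "x (Suc j) = \<phi> (x j)" for j by (simp add: x_def)
  let ?rec = "\<lambda>m. 0 < m \<and> (\<exists>a. x (a + m) mod N = x a mod N)"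
  have "\<exists>m. ?rec m"
  proof -
    have "\<not> inj_on (\<lambda>j. x j mod N) {..N}"
    proof (rule pigeonhole)
      have "(\<lambda>j. x j mod N) ` {..N} \<subseteq> {..<N}" using N0 by auto
      from card_mono[OF _ this] show "card ((\<lambda>j. x j mod N) ` {..N}) < card {..N}" by simp
    qed
    then obtain i j where "x i mod N = x j mod N" "i < j"
      using linorder_inj_onI'[of "{..N}" "\<lambda>j. x j mod N"] by blast
    then have "?rec (j - i)" by (auto intro!: exI[of _ i])
    then show ?thesis ..
  qed
  \<comment> \<open>The least recurrence time, so that the targets of the \<open>m\<close> jumps of
    one period are distinct modulo \<open>N\<close>.\<close>
  define m where "m = (LEAST m. ?rec m)"
  have "?rec m" unfolding m_def by (rule LeastI_ex) fact
  then obtain a where m: "0 < m" and a: "x (a + m) mod N = x a mod N" by blast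
  have m_le: "m \<le> m'" if "?rec m'" for m' unfolding m_def using that by (rule Least_le)
  define y where "y j = x (a + j)" for j
  have y_Suc: "y (Suc j) = \<phi> (y j)" for j by (simp add: y_def x_Suc)
  have y_mono: "strict_mono y" by (simp add: strict_mono_Suc_iff y_Suc \<phi>_gt)
  have "y 0 \<le> y m" using y_mono by (simp add: strict_mono_less_eq)
  then obtain r where r: "y m = y 0 + r * N"
    using a by (metis add.right_neutral le_add_diff_inverse mod_eq_dvd_iff_nat y_def dvdE mult.commute)
  have y_m: "y (j + m) = y j + r * N" for j
  proof (induction j)
    case 0 then show ?case using r by simp
  next
    case (Suc j) then show ?case by (simp add: y_Suc \<phi>_per')
  qed
  have y_lm: "y (l * m) = y 0 + l * r * N" for l
  proof (induction l)
    case (Suc l) then show ?case using y_m[of "l * m"] by (simp add: algebra_simps)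
  qed simp
  show ?thesis
  proof (cases "\<exists>j. c (y (j + k)) \<le> c (y j) + n")
    case True
    then obtain j where "c (y (j + k)) \<le> c (y j) + n" by blast
    then show ?thesis
      by (intro that[of "\<lambda>i. y (j + i)"]) (auto simp: y_Suc \<phi>)
  next
    case False
    then have big: "c (y j) + (n + 1) \<le> c (y (j + k))" for j by (simp add: not_le Suc_leI)
    \<comment> \<open>The orbit makes \<open>k * r\<close> rounds in \<open>m * k\<close> jumps,
      while each of the \<open>m\<close> blocks of \<open>k\<close> jumps advances by at least
      \<open>n + 1\<close>.\<close>
    have "c (y 0) + l * (n + 1) \<le> c (y (l * k))" for l
    proof (induction l)
      case (Suc l) then show ?case using big[of "l * k"] by (simp add: algebra_simps)
    qed simp
    from this[of m] have "m * (n + 1) \<le> k * r * n"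
      using y_lm[of k] per'[of "y 0" "k * r"] by (simp add: mult.commute)
    then have mkr: "m < k * r" using m
      by (metis add_leD1 less_add_one mult_le_mono1 mult_less_mono2 not_le order_trans less_le_trans)
    have "y j \<le> y 0 + j * q" for j
    proof (induction j)
      case (Suc j) then show ?case using \<phi>_q[of "y j"] by (simp add: y_Suc)
    qed simp
    from this[of m] have rN: "r * N \<le> m * q" using r by simp
    \<comment> \<open>The point just before the target is closer than \<open>2 * q\<close> to the
      start of the jump, so the jump has length at most \<open>2 * q - 1\<close> plus the gap
      \<open>G (t j)\<close>.\<close>
    define t where "t j = y (Suc j) - 1" for j
    have t: "y (Suc j) = Suc (t j)" for j
      using \<phi>_gt[of "y j"] by (simp add: t_def y_Suc)
    define G where "G i = c (Suc i) - c i" for i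
    have G2: "2 \<le> G i" for i using gap[of i] by (simp add: G_def)
    have G_mod: "G (i mod N) = G i" for i
      using per'[of "i mod N" "i div N"] per'[of "Suc (i mod N)" "i div N"] by (simp add: G_def)
    have step: "c (y (Suc j)) + 1 \<le> c (y j) + 2 * q + G (t j)" for j
      using \<phi>_less[of "t j" "y j"] gap[of "t j"] y_Suc[of j] t[of j] by (simp add: G_def)
    have "c (y l) + l \<le> c (y 0) + l * (2 * q) + (\<Sum>j<l. G (t j))" for l
    proof (induction l)
      case (Suc l) then show ?case using step[of l] by simp
    qed simp
    from this[of m] have A: "r * n + m \<le> m * (2 * q) + (\<Sum>j<m. G (t j))"
      using r per'[of "y 0" r] by simp
    have inj: "inj_on (\<lambda>j. t j mod N) {..<m}"
    proof -
      have "False" if "i < j" "j < m" "t i mod N = t j mod N" for i j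
      proof -
        have "y (Suc i) mod N = y (Suc j) mod N" using that(3) t by (metis mod_Suc_eq)
        then have "?rec (j - i)" using that
          by (auto simp: y_def intro!: exI[of _ "a + Suc i"])
        then show False using m_le[of "j - i"] that by simp
      qed
      then show ?thesis unfolding inj_on_def by (metis lessThan_iff linorder_neqE_nat)
    qed
    define R where "R = (\<lambda>j. t j mod N) ` {..<m}"
    have RN: "R \<subseteq> {..<N}" using N0 by (auto simp: R_def)
    have cR: "card R = m" using inj by (simp add: R_def card_image)
    have "(\<Sum>j<m. G (t j)) = (\<Sum>i\<in>R. G i)"
      unfolding R_def by (subst sum.reindex[OF inj]) (simp add: G_mod)
    moreover have "(\<Sum>i<N. G i) = (\<Sum>i\<in>R. G i) + (\<Sum>i\<in>{..<N} - R. G i)"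
      using RN by (simp add: sum.subset_diff add.commute)
    moreover have "2 * card ({..<N} - R) \<le> (\<Sum>i\<in>{..<N} - R. G i)"
      using sum_bounded_below[of "{..<N} - R" 2 G] G2 by (simp add: mult.commute)
    moreover have "(\<Sum>i<N. G i) = n"
    proof -
      have "c l = c 0 + (\<Sum>i<l. G i)" for l
      proof (induction l)
        case (Suc l) then show ?case using gap[of l] by (simp add: G_def)
      qed simp
      from this[of N] show ?thesis using per[of 0] by simp
    qed
    moreover have "card ({..<N} - R) + m = N"
      using RN cR card_mono[OF _ RN] by (simp add: card_Diff_subset finite_subset)
    \<comment> \<open>All gaps of a round sum to \<open>n\<close>, and the \<open>N - m\<close> gaps
      outside \<open>R\<close> are at least 2 each; this bounds the sum over \<open>R\<close> in
      \<open>A\<close>.\<close>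
    ultimately have "r * n + m + 2 * N \<le> m * (2 * q) + n + 2 * m" using A by linarith
    then have "int (r * n + m + 2 * N) \<le> int (m * (2 * q) + n + 2 * m)"
      by (simp only: of_nat_le_iff)
    then have B: "int r * int n + 2 * int N \<le> int m * (2 * int q + 1) + int n"
      by (simp add: algebra_simps)
    have r2: "2 \<le> r"
    proof (rule ccontr)
      assume "\<not> 2 \<le> r"
      moreover have "r \<noteq> 0" using mkr by (cases r) auto
      ultimately have "r = 1" by simp
      then have "m \<le> k - 1" "N \<le> m * q" using mkr rN by auto
      then have "N \<le> (k - 1) * q" by (meson le_trans mult_le_mono1)
      then show False using N by (simp add: mult.commute)
    qed
    have iN: "int N = int q * (int k - 1) + 1" using N \<open>0 < k\<close> by (simp add: of_nat_diff)
    have "int m \<le> int k * int r - 1" using mkr by (simp flip: of_nat_mult)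
    then have "int m * (2 * int q + 1) \<le> (int k * int r - 1) * (2 * int q + 1)"
      by (intro mult_right_mono) auto
    moreover have "(int r - 1) * ((2 * int q + 2) * int k - 2) \<le> (int r - 1) * int n"
    proof (rule mult_left_mono)
      have "int ((2 * q + 2) * k) \<le> int (n + 2)" using n by (simp only: of_nat_le_iff)
      then show "(2 * int q + 2) * int k - 2 \<le> int n" by (simp add: algebra_simps)
    qed (use r2 in simp)
    \<comment> \<open>After inserting the bounds for \<open>m\<close> and \<open>n\<close> and the
      value of \<open>N\<close> into \<open>B\<close>, all terms with \<open>q\<close>
      cancel.\<close>
    ultimately have "(int r - 2) * (int k - 2) + 1 \<le> 0" using B iN by (simp add: algebra_simps)
    moreover have "0 \<le> (int r - 2) * (int k - 2)" using r2 k by simp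
    ultimately show ?thesis by simp
  qed
qed

text \<open>Repeated with period \<open>n\<close>, the points of \<open>A\<close> form a sequence
  with gaps of at least 2. Greedy jumps along it are long, and \<open>k\<close> of them fit into one
  round, so their starting points project to a stable set.\<close>

lemma s_stable_subset:
  assumes A: "s_stable n 2 A" and card: "card A = q * (k - 1) + 1"
    and n: "(2 * q + 2) * k \<le> n + 2" and "0 < k" "0 < q"
  obtains S where "S \<subseteq> A" "s_stable n (2 * q) S" "card S = k"
proof -
  let ?N = "card A"
  let ?L = "sorted_list_of_set A"
  have AS: "A \<subseteq> {1..n}" using A by (simp add: s_stable_def)
  then have fin: "finite A" by (rule finite_subset) simp
  have L: "length ?L = ?N" "set ?L = A" "sorted_wrt (<) ?L" using fin by auto
  have N0: "0 < ?N" using card by simp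
  have LA: "?L ! (i mod ?N) \<in> A" for i using L N0 by (metis mod_less_divisor nth_mem)
  define c where "c i = ?L ! (i mod ?N) + n * (i div ?N)" for i
  have n2: "2 \<le> n"
  proof -
    have "(2 * q + 2) * 1 \<le> (2 * q + 2) * k" using \<open>0 < k\<close> by (intro mult_le_mono2) simp
    then show ?thesis using n \<open>0 < q\<close> by simp
  qed
  have gap: "c i + 2 \<le> c (Suc i)" for i
  proof (cases "Suc (i mod ?N) = ?N")
    case True
    \<comment> \<open>The two points coincide when \<open>A\<close> is a singleton; the gap across
      the end of the round is then \<open>n\<close> itself.\<close>
    have "?L ! (i mod ?N) + 2 \<le> ?L ! 0 + n"
    proof (cases "?L ! (i mod ?N) = ?L ! 0")
      case False
      then show ?thesis using A LA[of i] LA[of 0] unfolding s_stable_def by fastforce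
    qed (use n2 in simp)
    then show ?thesis using True by (simp add: c_def mod_Suc div_Suc)
  next
    case False
    then have s: "Suc (i mod ?N) < ?N" using N0 by (metis Suc_lessI mod_less_divisor)
    then have "?L ! (i mod ?N) < ?L ! Suc (i mod ?N)"
      using L by (metis lessI sorted_wrt_nth_less)
    moreover have "?L ! Suc (i mod ?N) \<in> A" using s L by (metis nth_mem)
    ultimately have "?L ! (i mod ?N) + 2 \<le> ?L ! Suc (i mod ?N)"
      using A LA[of i] unfolding s_stable_def by fastforce
    then show ?thesis using s False by (simp add: c_def mod_Suc div_Suc)
  qed
  have "c (i + ?N) = c i + n" for i using N0 by (simp add: c_def)
  from greedy_jumps[OF this gap card n \<open>0 < k\<close> \<open>0 < q\<close>]
  obtain g where g: "\<And>j. c (g j) + 2 * q \<le> c (g (Suc j))" "c (g k) \<le> c (g 0) + n" by blast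
  define v where "v j = ?L ! (g j mod ?N)" for j
  have v: "v j \<in> A" "1 \<le> v j" "v j \<le> n" for j using LA[of "g j"] AS by (auto simp: v_def)
  have sep: "2 * int q \<le> \<bar>int (v i) - int (v j)\<bar> \<and> \<bar>int (v i) - int (v j)\<bar> \<le> int n - 2 * int q"
    if "i < j" "j < k" for i j
  proof -
    have mono: "c (g i) \<le> c (g j)" if "i \<le> j" for i j
      using that by (rule lift_Suc_mono_le[of "\<lambda>j. c (g j)", rotated]) (use g(1) add_leD1 in blast)
    have D: "c (g i) + 2 * q \<le> c (g j)" using g(1)[of i] mono[of "Suc i" j] that by simp
    \<comment> \<open>One more jump from \<open>g j\<close> does not pass \<open>g k\<close>, which
      lies within one round of \<open>g 0\<close>; this gives the distance the other way round the
      cycle.\<close>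
    have D': "c (g j) + 2 * q \<le> c (g i) + n"
      using g(1)[of j] g(2) mono[of "Suc j" k] mono[of 0 i] that by simp
    \<comment> \<open>Both points lie in \<open>{1..n}\<close> and the lifted distance is strictly
      between 0 and \<open>n\<close>, so they are in the same round or in consecutive ones; either
      case gives the cyclic distance.\<close>
    define E where "E = int (g j div ?N) - int (g i div ?N)"
    have e: "int (c (g j)) - int (c (g i)) = int (v j) - int (v i) + int n * E"
      by (simp add: c_def v_def E_def algebra_simps)
    have b: "2 * int q \<le> int (c (g j)) - int (c (g i))" "int (c (g j)) - int (c (g i)) \<le> int n - 2 * int q"
      using D D' by linarith+
    have lo: "int n * (-1) < int n * E" and hi: "int n * E < int n * 2"
      using e b v[of i] v[of j] \<open>0 < q\<close> by linarith+
    have "- 1 < E" "E < 2" using lo hi by (auto simp only: mult_less_cancel_left)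
    then have "E = 0 \<or> E = 1" by linarith
    then show ?thesis using e b \<open>0 < q\<close> by auto
  qed
  have inj: "inj_on v {..<k}"
  proof -
    have "v i \<noteq> v j" if "i < j" "j < k" for i j using sep[OF that] \<open>0 < q\<close> by auto
    then show ?thesis unfolding inj_on_def by (metis lessThan_iff linorder_neqE_nat)
  qed
  show ?thesis
  proof
    show "v ` {..<k} \<subseteq> A" using v by auto
    show "card (v ` {..<k}) = k" using inj by (simp add: card_image)
    have "2 * int q \<le> \<bar>int (v i) - int (v j)\<bar> \<and> \<bar>int (v i) - int (v j)\<bar> \<le> int n - 2 * int q"
      if "i < k" "j < k" "v i \<noteq> v j" for i j
    proof (cases "i < j")
      case True then show ?thesis using sep that by blast
    next
      case False
      then have "j < i" using that(3) by (metis linorder_neqE_nat)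
      then show ?thesis using sep[of j i] that by (simp add: abs_minus_commute)
    qed
    then show "s_stable n (2 * q) (v ` {..<k})"
      using v \<open>0 < k\<close> unfolding s_stable_def by auto
  qed
qed

section \<open>Alternating colours on 2-stable sets\<close>

text \<open>For a sign vector, \<open>side True\<close> is its positive support and
  \<open>side False\<close> its negative support, both read as sets of points of the cycle.\<close>

definition side :: "bool \<Rightarrow> int set \<Rightarrow> nat set" where
  "side b A = {x. (if b then int x else - int x) \<in> A}"

lemma side_mono: "A \<subseteq> B \<Longrightarrow> side b A \<subseteq> side b B"
  by (auto simp: side_def)

lemma side_uminus: "side b (uminus ` A) = side (\<not> b) A"
proof -
  have "z \<in> uminus ` A \<longleftrightarrow> - z \<in> A" for z :: int
    by (metis image_iff minus_minus)
  then show ?thesis by (auto simp: side_def)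
qed

lemma side_disjoint:
  assumes "\<forall>x\<in>A. - x \<notin> A" shows "side b A \<inter> side (\<not> b) A = {}"
  using assms by (cases b) (auto simp: side_def)

text \<open>Between two chosen entries lies one of the other parity, so they differ by at least 2.
  Across the end of the cycle, an entry of the other parity lies below all chosen ones if
  \<open>r = 0\<close> and above them if \<open>r = 1\<close>.\<close>

lemma alternating_stable_sets:
  fixes a :: "nat \<Rightarrow> nat"
  assumes range: "\<And>i. i < 2 * m \<Longrightarrow> a i \<in> {1..n}"
    and dec: "\<And>i. Suc i < 2 * m \<Longrightarrow> a (Suc i) < a i" and "0 < m" "r < 2"
  shows "s_stable n 2 ((\<lambda>j. a (2 * j + r)) ` {..<m})" "card ((\<lambda>j. a (2 * j + r)) ` {..<m}) = m"
proof -
  have dist: "i \<le> j \<Longrightarrow> j < 2 * m \<Longrightarrow> a j + j \<le> a i + i" for i j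
  proof (induction j)
    case (Suc j)
    then show ?case using dec[of j] by (cases "i = Suc j") auto
  qed simp
  have sep: "a (2 * j + r) + 2 \<le> a (2 * i + r) \<and> a (2 * i + r) + 2 \<le> a (2 * j + r) + n"
    if "i < j" "j < m" for i j
  proof (cases "r = 0")
    case True
    have "a (2 * j) + 2 * j \<le> a (2 * i) + 2 * i" using that by (intro dist) auto
    moreover have "a (Suc (2 * j)) < a (2 * j)" using that by (intro dec) auto
    moreover have "a (Suc (2 * j)) \<in> {1..n}" using that by (intro range) auto
    moreover have "a (2 * i) \<in> {1..n}" using that by (intro range) auto
    ultimately show ?thesis using that True by auto
  next
    case False
    then have r: "r = 1" using \<open>r < 2\<close> by simp
    have "a (Suc (2 * j)) + Suc (2 * j) \<le> a (Suc (2 * i)) + Suc (2 * i)" using that by (intro dist) auto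
    moreover have "a (Suc (2 * i)) < a (2 * i)" using that by (intro dec) auto
    moreover have "a (Suc (2 * j)) \<in> {1..n}" using that by (intro range) auto
    moreover have "a (2 * i) \<in> {1..n}" using that by (intro range) auto
    ultimately show ?thesis using that r by auto
  qed
  have "inj_on (\<lambda>j. a (2 * j + r)) {..<m}"
  proof (rule linorder_inj_onI')
    fix i j assume "i \<in> {..<m}" "j \<in> {..<m}" "i < j"
    then show "a (2 * i + r) \<noteq> a (2 * j + r)" using sep[of i j] by simp
  qed
  then show "card ((\<lambda>j. a (2 * j + r)) ` {..<m}) = m" by (simp add: card_image)
  have "2 \<le> \<bar>int (a (2 * i + r)) - int (a (2 * j + r))\<bar> \<and>
      \<bar>int (a (2 * i + r)) - int (a (2 * j + r))\<bar> \<le> int n - 2"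
    if "i < m" "j < m" "a (2 * i + r) \<noteq> a (2 * j + r)" for i j
  proof -
    have "i < j \<or> j < i" using that by (metis linorder_neqE_nat)
    then show ?thesis using sep[of i j] sep[of j i] that by auto
  qed
  moreover have "a (2 * j + r) \<in> {1..n}" if "j < m" for j
    using that \<open>r < 2\<close> by (intro range) auto
  ultimately show "s_stable n 2 ((\<lambda>j. a (2 * j + r)) ` {..<m})"
    using \<open>0 < m\<close> unfolding s_stable_def by auto
qed

text \<open>Call a sign vector rich if both of its sides contain a stable set. It gets the sign of the side
  with the larger maximal colour; any other vector gets the sign of its first entry. In an alternating
  flag the first entries of the poor members move down and alternate, so that a flag whose first
  \<open>2 * m\<close> members were all poor would contain \<open>2 * m\<close> alternating entries, making it rich. The
  remaining, rich members yield the sets, the first of them contributing one on each side.\<close>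

lemma alternating_colours:
  fixes c :: "nat set \<Rightarrow> nat"
  assumes "0 < m" "2 * m \<le> n"
    and proper: "\<And>S T. s_stable n 2 S \<Longrightarrow> card S = m \<Longrightarrow> s_stable n 2 T \<Longrightarrow> card T = m
        \<Longrightarrow> S \<inter> T = {} \<Longrightarrow> c S \<noteq> c T"
  obtains v :: "nat \<Rightarrow> nat set" where
    "\<And>i. i < n - 2 * m + 2 \<Longrightarrow> s_stable n 2 (v i)"
    "\<And>i. i < n - 2 * m + 2 \<Longrightarrow> card (v i) = m"
    "\<And>i j. i < n - 2 * m + 2 \<Longrightarrow> j < n - 2 * m + 2 \<Longrightarrow> odd (i + j) \<Longrightarrow> v i \<inter> v j = {}"
    "\<And>i. Suc i < n - 2 * m + 2 \<Longrightarrow> c (v i) < c (v (Suc i))"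
proof -
  define F where "F b A = {S. s_stable n 2 S \<and> card S = m \<and> S \<subseteq> side b A}" for b A
  have finF: "finite (F b A)" for b A
    by (rule finite_subset[OF _ finite_s_stable[of n 2]]) (auto simp: F_def)
  have F_mono: "F b A \<subseteq> F b B" if "A \<subseteq> B" for b A B
    using side_mono[OF that] by (auto simp: F_def)
  have F_uminus: "F b (uminus ` A) = F (\<not> b) A" for b A by (simp add: F_def side_uminus)
  define rich where "rich A \<longleftrightarrow> (\<forall>b. F b A \<noteq> {})" for A
  have rich_mono: "rich B" if "rich A" "A \<subseteq> B" for A B
    using that F_mono[OF that(2)] unfolding rich_def by blast
  have rich_uminus: "rich (uminus ` A) \<longleftrightarrow> rich A" for A
    by (auto simp: rich_def F_uminus all_bool_eq)
  define M where "M b A = Max (c ` F b A)" for b A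
  have M_in: "\<exists>S\<in>F b A. c S = M b A" if "rich A" for b A
  proof -
    have "M b A \<in> c ` F b A" unfolding M_def using that finF by (intro Max_in) (auto simp: rich_def)
    then show ?thesis by auto
  qed
  have M_mono: "M b A \<le> M b B" if "rich A" "A \<subseteq> B" for b A B
    unfolding M_def using that F_mono[OF that(2)] finF by (intro Max_mono image_mono) (auto simp: rich_def)
  have M_uminus: "M b (uminus ` A) = M (\<not> b) A" for b A by (simp add: M_def F_uminus)
  \<comment> \<open>The two maxima are attained by sets on opposite sides; these are disjoint, so
    \<open>proper\<close> separates their colours.\<close>
  have M_neq: "M b A \<noteq> M (\<not> b) A" if r: "rich A" and A: "\<forall>x\<in>A. - x \<notin> A" for b A
  proof -
    obtain S T where "S \<in> F b A" "c S = M b A" "T \<in> F (\<not> b) A" "c T = M (\<not> b) A"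
      using M_in[OF r] by metis
    moreover from this have "S \<inter> T = {}" using side_disjoint[OF A, of b] by (auto simp: F_def)
    ultimately show ?thesis using proper[of S T] by (auto simp: F_def)
  qed

  define \<sigma> where "\<sigma> A \<longleftrightarrow> (if rich A then M False A < M True A
     else (\<exists>x\<in>A. 0 < x \<and> (\<forall>y\<in>A. \<bar>x\<bar> \<le> \<bar>y\<bar>)))" for A
  have ex_min: "\<exists>x\<in>A. \<forall>y\<in>A. \<bar>x\<bar> \<le> \<bar>y\<bar>" if "finite A" "A \<noteq> {}" for A :: "int set"
    using that ex_min_if_finite[of "abs ` A"] by (auto simp: not_less)
  have poor: "\<sigma> A \<longleftrightarrow> 0 < x"
    if "\<not> rich A" "\<forall>x\<in>A. - x \<notin> A" "x \<in> A" "\<forall>y\<in>A. \<bar>x\<bar> \<le> \<bar>y\<bar>" for A x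
  proof -
    have "z = x" if z: "z \<in> A" "\<forall>y\<in>A. \<bar>z\<bar> \<le> \<bar>y\<bar>" for z
    proof -
      have "\<bar>z\<bar> = \<bar>x\<bar>" using z \<open>x \<in> A\<close> \<open>\<forall>y\<in>A. \<bar>x\<bar> \<le> \<bar>y\<bar>\<close> by (meson order_antisym)
      then have "z = x \<or> z = - x" by (simp add: abs_eq_iff)
      then show ?thesis using z(1) \<open>x \<in> A\<close> \<open>\<forall>x\<in>A. - x \<notin> A\<close> by blast
    qed
    moreover have "\<sigma> A \<longleftrightarrow> (\<exists>x\<in>A. 0 < x \<and> (\<forall>y\<in>A. \<bar>x\<bar> \<le> \<bar>y\<bar>))"
      using that(1) by (simp add: \<sigma>_def)
    ultimately show ?thesis using that(3,4) by metis
  qed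
  have anti: "\<sigma> (uminus ` A) \<longleftrightarrow> \<not> \<sigma> A"
    if A: "finite A" "A \<noteq> {}" "\<forall>x\<in>A. - x \<notin> A" for A
  proof (cases "rich A")
    case True
    then show ?thesis using M_neq[OF True A(3), of True]
      by (auto simp: \<sigma>_def rich_uminus M_uminus)
  next
    case False
    obtain x where x: "x \<in> A" "\<forall>y\<in>A. \<bar>x\<bar> \<le> \<bar>y\<bar>" using ex_min[OF A(1,2)] by blast
    have "x \<noteq> 0" using A(3) x(1) by force
    have "\<sigma> A \<longleftrightarrow> 0 < x" by (rule poor[OF False A(3) x])
    moreover have "\<sigma> (uminus ` A) \<longleftrightarrow> 0 < - x"
    proof (rule poor)
      show "\<not> rich (uminus ` A)" using False by (simp add: rich_uminus)
      show "\<forall>x\<in>uminus ` A. - x \<notin> uminus ` A" using A(3) by force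
      show "- x \<in> uminus ` A" using x(1) by simp
      show "\<forall>y\<in>uminus ` A. \<bar>- x\<bar> \<le> \<bar>y\<bar>" using x(2) by simp
    qed
    ultimately show ?thesis using \<open>x \<noteq> 0\<close> by auto
  qed
  have "odd (card {w \<in> signed_perms n. \<forall>t<n. agrees \<sigma> w t})"
    by (rule odd_card_alternating) (rule anti)
  then have "{w \<in> signed_perms n. \<forall>t<n. agrees \<sigma> w t} \<noteq> {}" by (metis card.empty even_zero)
  then obtain w where w: "w \<in> signed_perms n" and agr: "\<And>t. t < n \<Longrightarrow> agrees \<sigma> w t" by blast
  define X where "X i = set (take (Suc i) w)" for i
  have X_mono: "X i \<subseteq> X j" if "i \<le> j" for i j
    using that by (simp add: X_def set_take_subset_set_take)
  have X_w: "X i \<subseteq> set w" for i by (simp add: X_def set_take_subset)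
  have cons_w: "\<forall>x\<in>set w. - x \<notin> set w" using signed_perms_consistent[OF w] by blast
  have cons: "\<forall>x\<in>X i. - x \<notin> X i" for i using X_w[of i] cons_w by blast
  have X_fin: "finite (X i)" "X i \<noteq> {}" if "i < n" for i
    using that length_signed_perms[OF w] by (auto simp: X_def)
  have \<sigma>_X: "\<sigma> (X i) \<longleftrightarrow> even i" if "i < n" for i using agr[OF that] by (simp add: agrees_def X_def)

  have rich_X: "rich (X (2 * m - 1))"
  proof (rule ccontr)
    assume nr: "\<not> rich (X (2 * m - 1))"
    have nr_X: "\<not> rich (X i)" if "i < 2 * m" for i
      using nr rich_mono X_mono[of i "2 * m - 1"] that by (metis Suc_pred' \<open>0 < m\<close> less_Suc_eq_le nat_0_less_mult_iff pos2)
    have "\<forall>i. \<exists>x. i < n \<longrightarrow> x \<in> X i \<and> (\<forall>y\<in>X i. \<bar>x\<bar> \<le> \<bar>y\<bar>)"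
      using ex_min X_fin by meson
    then obtain e where e: "\<And>i. i < n \<Longrightarrow> e i \<in> X i" "\<And>i y. i < n \<Longrightarrow> y \<in> X i \<Longrightarrow> \<bar>e i\<bar> \<le> \<bar>y\<bar>"
      by metis
    have e_sign: "0 < e i \<longleftrightarrow> even i" if "i < 2 * m" for i
    proof -
      have "i < n" using that \<open>2 * m \<le> n\<close> by simp
      then show ?thesis using poor[OF nr_X[OF that] cons e(1)] e(2) \<sigma>_X by blast
    qed
    define a where "a i = nat \<bar>e i\<bar>" for i
    have a_range: "a i \<in> {1..n}" if "i < 2 * m" for i
    proof -
      have "e i \<in> set w" using e(1)[of i] X_w that \<open>2 * m \<le> n\<close> by fastforce
      then have "\<bar>e i\<bar> \<in> {1..int n}" using w by (auto simp: signed_perms_def)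
      then show ?thesis by (auto simp: a_def)
    qed
    \<comment> \<open>A larger set has a smaller or equal least absolute value. Equality would force
      \<open>e (Suc i) = - e i\<close> because the signs differ, with both entries in
      \<open>X (Suc i)\<close>.\<close>
    have a_dec: "a (Suc i) < a i" if "Suc i < 2 * m" for i
    proof -
      have n: "Suc i < n" using that \<open>2 * m \<le> n\<close> by simp
      have ei: "e i \<in> X (Suc i)" using e(1)[of i] X_mono[of i "Suc i"] n by auto
      have "\<bar>e (Suc i)\<bar> \<le> \<bar>e i\<bar>" using e(2)[OF n ei] .
      moreover have "\<bar>e (Suc i)\<bar> \<noteq> \<bar>e i\<bar>"
      proof
        assume "\<bar>e (Suc i)\<bar> = \<bar>e i\<bar>"
        then have "e (Suc i) = e i \<or> e (Suc i) = - e i" by (simp add: abs_eq_iff)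
        moreover have "e (Suc i) \<noteq> e i" using e_sign[of i] e_sign[of "Suc i"] that by auto
        ultimately show False using ei e(1)[OF n] cons by metis
      qed
      ultimately show ?thesis by (simp add: a_def)
    qed
    have "F b (X (2 * m - 1)) \<noteq> {}" for b
    proof -
      \<comment> \<open>The entries of even index are positive and those of odd index
        negative.\<close>
      define r :: nat where "r = (if b then 0 else 1)"
      have "a (2 * j + r) \<in> side b (X (2 * m - 1))" if "j < m" for j
      proof -
        have l: "2 * j + r < 2 * m" using that by (simp add: r_def)
        then have "e (2 * j + r) \<in> X (2 * j + r)" "X (2 * j + r) \<subseteq> X (2 * m - 1)"
          using \<open>2 * m \<le> n\<close> by (intro e(1) X_mono; linarith)+
        then have "e (2 * j + r) \<in> X (2 * m - 1)" by blast
        moreover have "0 < e (2 * j + r) \<longleftrightarrow> b" using e_sign[OF l] by (simp add: r_def)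
        ultimately show ?thesis by (cases b) (auto simp: side_def a_def)
      qed
      then have "(\<lambda>j. a (2 * j + r)) ` {..<m} \<in> F b (X (2 * m - 1))"
        using alternating_stable_sets[of m a n r, OF a_range a_dec \<open>0 < m\<close>] by (auto simp: F_def r_def)
      then show ?thesis by blast
    qed
    then show False using nr by (simp add: rich_def)
  qed

  \<comment> \<open>From \<open>p\<close> on there are at least \<open>n - 2 * m + 1\<close>
    members, all rich; the extra set from the losing side of \<open>X p\<close> completes the
    required number.\<close>
  define p where "p = (LEAST i. rich (X i))"
  have p: "rich (X p)" unfolding p_def using rich_X by (rule LeastI)
  have "p \<le> 2 * m - 1" unfolding p_def using rich_X by (rule Least_le)
  then have pn: "i \<le> n - p \<and> p < n" if "i < n - 2 * m + 2" for i
    using that \<open>2 * m \<le> n\<close> \<open>0 < m\<close> by linarith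
  have rich: "rich (X i)" if "p \<le> i" for i using rich_mono[OF p X_mono[OF that]] .
  have M_less: "M (odd i) (X i) < M (even i) (X i)" if "p \<le> i" "i < n" for i
    using \<sigma>_X[OF that(2)] rich[OF that(1)] M_neq[OF rich[OF that(1)] cons, of True]
    by (cases "even i") (auto simp: \<sigma>_def)
  have "\<forall>i. \<exists>S. p \<le> i \<longrightarrow> S \<in> F (even i) (X i) \<and> c S = M (even i) (X i)"
    using M_in rich by meson
  then obtain V where V: "\<And>i. p \<le> i \<Longrightarrow> V i \<in> F (even i) (X i)"
    "\<And>i. p \<le> i \<Longrightarrow> c (V i) = M (even i) (X i)" by metis
  \<comment> \<open>The winning side of \<open>X i\<close> is \<open>even i\<close>, so
    \<open>V0\<close> has the maximal colour on the losing side of \<open>X p\<close> and precedes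
    \<open>V p\<close>.\<close>
  obtain V0 where V0: "V0 \<in> F (odd p) (X p)" "c V0 = M (odd p) (X p)" using M_in[OF p] by blast
  define v where "v i = (case i of 0 \<Rightarrow> V0 | Suc j \<Rightarrow> V (p + j))" for i
  have vF: "v i \<in> F (odd (p + i)) (set w)" for i
  proof (cases i)
    case 0
    then show ?thesis using V0(1) F_mono[OF X_w[of p]] by (auto simp: v_def)
  next
    case (Suc j)
    then show ?thesis using V(1)[of "p + j"] F_mono[OF X_w[of "p + j"]] by (auto simp: v_def)
  qed
  show ?thesis
  proof
    show "s_stable n 2 (v i)" "card (v i) = m" for i using vF[of i] by (simp_all add: F_def)
    show "v i \<inter> v j = {}" if "odd (i + j)" for i j
    proof -
      have "odd (p + j) \<longleftrightarrow> \<not> odd (p + i)" using that by auto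
      then show ?thesis
        using vF[of i] vF[of j] side_disjoint[OF cons_w, of "odd (p + i)"] by (auto simp: F_def)
    qed
    show "c (v i) < c (v (Suc i))" if "Suc i < n - 2 * m + 2" for i
    proof (cases i)
      case 0
      then show ?thesis using V0(2) V(2)[of p] M_less[of p] pn[OF that] by (simp add: v_def)
    next
      case (Suc j)
      \<comment> \<open>The winning side of one member is the losing side of the next. Its maximal
        colour cannot drop as the member grows, and it stays below that of the new winning
        side.\<close>
      have "M (even (p + j)) (X (p + j)) \<le> M (even (p + j)) (X (Suc (p + j)))"
        by (intro M_mono rich X_mono) auto
      also have "\<dots> < M (even (Suc (p + j))) (X (Suc (p + j)))"
      proof -
        have "Suc (p + j) < n" using pn[OF that] Suc by linarith
        then show ?thesis using M_less[of "Suc (p + j)"] by simp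
      qed
      finally show ?thesis using V(2)[of "p + j"] V(2)[of "Suc (p + j)"] Suc by (simp add: v_def)
    qed
  qed
qed

section \<open>The circular chromatic number\<close>

lemma stable_kneser_to_circular_complete:
  assumes hom: "graph_homomorphism (stable_kneser_graph s n k) (circular_complete_graph p d) f"
    and "even n" "even s" "0 < s" "0 < k" and n: "(s + 2) * k \<le> n + 2"
  shows "(n - s * (k - 1)) * d \<le> p"
proof -
  obtain q where q: "s = 2 * q" using \<open>even s\<close> by blast
  have q0: "0 < q" using \<open>0 < s\<close> q by simp
  define m where "m = q * (k - 1) + 1"
  define t where "t = n - 2 * m + 2"
  obtain k' where k': "k = Suc k'" using \<open>0 < k\<close> by (cases k) auto
  have mn: "2 * m \<le> n" using n q0 by (simp add: m_def q k' algebra_simps)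
  have t: "t = n - s * (k - 1)" using mn by (simp add: t_def m_def q)
  have "even t" using \<open>even n\<close> by (simp add: t q)
  have t2: "2 \<le> t" by (simp add: t_def)
  define P where "P A S \<longleftrightarrow> S \<subseteq> A \<and> s_stable n s S \<and> card S = k" for A S
  have "\<exists>S. P A S" if "s_stable n 2 A" "card A = m" for A
    using s_stable_subset[of n A q k thesis for thesis] that n q0 \<open>0 < k\<close> unfolding P_def m_def q by metis
  then obtain h where h: "\<And>A. s_stable n 2 A \<Longrightarrow> card A = m \<Longrightarrow> P A (h A)" by metis
  define c where "c A = f (h A)" for A
  \<comment> \<open>Subsets of disjoint sets are disjoint, so \<open>h\<close> preserves
    adjacency.\<close>
  have arc: "(c A, c B) \<in> parcs (circular_complete_graph p d)"
    if "s_stable n 2 A" "card A = m" "s_stable n 2 B" "card B = m" "A \<inter> B = {}" for A B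
  proof -
    have "(h A, h B) \<in> parcs (stable_kneser_graph s n k)"
      using h[OF that(1,2)] h[OF that(3,4)] that(5)
      by (auto simp: stable_kneser_graph_def P_def)
    then show ?thesis using hom unfolding graph_homomorphism_def c_def by auto
  qed
  show ?thesis
  proof (cases "d = 0")
    case False
    have "c A \<noteq> c B"
      if "s_stable n 2 A" "card A = m" "s_stable n 2 B" "card B = m" "A \<inter> B = {}" for A B
      using arc[OF that] False by (auto simp: circular_complete_graph_def)
    then obtain v where v: "\<And>i. i < t \<Longrightarrow> s_stable n 2 (v i)" "\<And>i. i < t \<Longrightarrow> card (v i) = m"
      "\<And>i j. i < t \<Longrightarrow> j < t \<Longrightarrow> odd (i + j) \<Longrightarrow> v i \<inter> v j = {}"
      "\<And>i. Suc i < t \<Longrightarrow> c (v i) < c (v (Suc i))"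
      using alternating_colours[of m n c] mn unfolding t_def m_def by auto
    have dist: "int d \<le> \<bar>int (c (v i)) - int (c (v j))\<bar> \<and> \<bar>int (c (v i)) - int (c (v j))\<bar> \<le> int p - int d"
      if "i < t" "j < t" "odd (i + j)" for i j
      using arc[OF v(1,2)[OF that(1)] v(1,2)[OF that(2)] v(3)[OF that]]
      by (auto simp: circular_complete_graph_def)
    have "int (c (v 0)) + int i * int d \<le> int (c (v i))" if "i < t" for i
      using that
    proof (induction i)
      case (Suc i)
      then show ?case using dist[of i "Suc i"] v(4)[of i] by (simp add: algebra_simps)
    qed simp
    from this[of "t - 1"] have "int (c (v 0)) + (int t - 1) * int d \<le> int (c (v (t - 1)))"
      using t2 by (simp add: of_nat_diff)
    \<comment> \<open>As \<open>t\<close> is even, 0 and \<open>t - 1\<close> have opposite parity,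
      so the first and the last set are disjoint too.\<close>
    moreover have "\<bar>int (c (v 0)) - int (c (v (t - 1)))\<bar> \<le> int p - int d"
      using dist[of 0 "t - 1"] t2 \<open>even t\<close> by simp
    ultimately have "int t * int d \<le> int p" by (simp add: algebra_simps)
    then show ?thesis unfolding t by (simp only: of_nat_le_iff flip: of_nat_mult)
  qed simp
qed

section \<open>Upper bound from minima\<close>

text \<open>Elements at distance at least \<open>s\<close> have different quotients
  \<open>(x - Min S) div s\<close>, so these take \<open>k\<close> values from 0 to
  \<open>(n - Min S) div s\<close>.\<close>

lemma s_stable_Min_le:
  assumes "s_stable n s S" "card S = k" "0 < s"
  shows "Min S + s * (k - 1) \<le> n"
proof -
  have S: "S \<subseteq> {1..n}" "S \<noteq> {}" using assms by (auto simp: s_stable_def)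
  then have fin: "finite S" by (meson finite_atLeastAtMost finite_subset)
  have Mn: "Min S \<in> S" "\<And>x. x \<in> S \<Longrightarrow> Min S \<le> x" using fin S by auto
  have "inj_on (\<lambda>x. (x - Min S) div s) S"
  proof (rule linorder_inj_onI')
    fix x y assume xy: "x \<in> S" "y \<in> S" "x < y"
    then have "x + s \<le> y" using assms(1) unfolding s_stable_def by fastforce
    then have "(x - Min S) + s \<le> y - Min S" using Mn(2)[OF xy(1)] by simp
    then have "((x - Min S) + s) div s \<le> (y - Min S) div s" by (rule div_le_mono)
    then show "(x - Min S) div s \<noteq> (y - Min S) div s" using \<open>0 < s\<close> by simp
  qed
  moreover have "(\<lambda>x. (x - Min S) div s) ` S \<subseteq> {..(n - Min S) div s}"
    using S by (auto intro!: div_le_mono diff_le_mono)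
  ultimately have "card S \<le> card {..(n - Min S) div s}" by (intro card_inj_on_le) auto
  then have "k - 1 \<le> (n - Min S) div s" using assms by simp
  then have "s * (k - 1) \<le> s * ((n - Min S) div s)" by simp
  also have "\<dots> \<le> n - Min S" by simp
  finally have "s * (k - 1) \<le> n - Min S" .
  moreover have "Min S \<le> n" using Mn(1) S by auto
  ultimately show ?thesis by linarith
qed

theorem theorem5:
  fixes n k s :: nat
  assumes "0 < n" and "0 < k" and "0 < s"
    and "even n" and "even s"
    and "int n \<ge> (int s + 2) * int k - 2"
  shows "circular_chromatic_number (stable_kneser_graph s n k)
           = real n - real s * (real k - 1)"
proof -
  have "int ((s + 2) * k) \<le> int (n + 2)" using assms(6) by (simp add: algebra_simps)
  then have n: "(s + 2) * k \<le> n + 2" by (simp only: of_nat_le_iff)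
  obtain k' where k': "k = Suc k'" using \<open>0 < k\<close> by (cases k) auto
  define t where "t = n - s * (k - 1)"
  \<comment> \<open>This makes the truncated subtraction in \<open>t\<close> exact and
    \<open>t\<close> positive, as an admissible numerator must be.\<close>
  have t0: "s * (k - 1) < n"
    using n \<open>0 < s\<close> \<open>0 < n\<close> \<open>even s\<close> by (cases "s = 1") (auto simp: k' algebra_simps)
  have t: "real t = real n - real s * (real k - 1)"
    using t0 by (simp add: t_def k' of_nat_diff)
  \<comment> \<open>With \<open>d = 1\<close> the target is the ordinary complete graph on
    \<open>t\<close> vertices, so it suffices that disjoint sets have different minima in
    \<open>{1..t}\<close>.\<close>
  have hom: "graph_homomorphism (stable_kneser_graph s n k) (circular_complete_graph t 1) Min"
  proof -
    have m: "Min S \<in> S \<and> Min S \<in> {1..t}" if "s_stable n s S" "card S = k" for S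
    proof -
      have S: "S \<subseteq> {1..n}" "S \<noteq> {}" using that by (auto simp: s_stable_def)
      then have "Min S \<in> S" by (intro Min_in) (auto intro: finite_subset)
      then show ?thesis using S s_stable_Min_le[OF that \<open>0 < s\<close>] by (auto simp: t_def)
    qed
    have "Min S \<noteq> Min T" if "s_stable n s S" "card S = k" "s_stable n s T" "card T = k" "S \<inter> T = {}" for S T
      using m[OF that(1,2)] m[OF that(3,4)] that(5) by auto
    then have "1 \<le> \<bar>int (Min S) - int (Min T)\<bar> \<and> \<bar>int (Min S) - int (Min T)\<bar> \<le> int t - 1"
      if "s_stable n s S" "card S = k" "s_stable n s T" "card T = k" "S \<inter> T = {}" for S T
      using m[OF that(1,2)] m[OF that(3,4)] that by fastforce
    then show ?thesis using m
      by (auto simp: graph_homomorphism_def stable_kneser_graph_def circular_complete_graph_def)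
  qed
  have "real t \<le> real p / real d"
    if "0 < d" "graph_homomorphism (stable_kneser_graph s n k) (circular_complete_graph p d) f" for p d f
  proof -
    have "t * d \<le> p"
      using stable_kneser_to_circular_complete[OF that(2) assms(4,5,3,2) n] by (simp add: t_def)
    then have "real (t * d) \<le> real p" by (simp only: of_nat_le_iff)
    then show ?thesis using \<open>0 < d\<close> by (simp add: pos_le_divide_eq)
  qed
  moreover have "\<exists>p d. real t = real p / real d \<and> 0 < p \<and> 0 < d \<and>
      (\<exists>f. graph_homomorphism (stable_kneser_graph s n k) (circular_complete_graph p d) f)"
    using hom t0 by (intro exI[of _ t] exI[of _ 1]) (auto simp: t_def)
  ultimately have "circular_chromatic_number (stable_kneser_graph s n k) = real t"
    unfolding circular_chromatic_number_def by (intro cInf_eq_minimum) auto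
  then show ?thesis using t by simp
qed

end
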